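(* For every problem $f$: (1) $\Pi\Sigma f\leq_{\mathrm{sW}}\Sigma\Pi f$; (2) $\Pi\Sigma\Pi f\equiv_{\mathrm{sW}}\Sigma\Pi f$; (3) $\Sigma\Pi\Sigma f\equiv_{\mathrm{sW}}\Pi\Sigma f$.
   Context: A represented space is a set $X$ with a partial surjective map $\delta_X:\subseteq\mathbb N^{\mathbb N}\to X$. A problem is a partial multi-valued function $f:\subseteq X\rightrightarrows Y$ between represented spaces that has a realizer; a realizer of $f$ is a function $F:\subseteq\mathbb N^{\mathbb N}\to\mathbb N^{\mathbb N}$ with $\delta_YF(p)\in f\delta_X(p)$ for all $p\in\mathrm{dom}(f\delta_X)$. For problems $f,g$: $f\leq_{\mathrm{sW}}g$ if there are computable $H,K:\subseteq\mathbb N^{\mathbb N}\to\mathbb N^{\mathbb N}$ such that $HGK$ is a realizer of $f$ whenever $G$ is a realizer of $g$; $f\equiv_{\mathrm{sW}}g$ means $f\leq_{\mathrm{sW}}g$ and $g\leq_{\mathrm{sW}}f$. For a represented space $Y$, the completion $\overline Y:=Y\cup\{\bot\}$ ($\bot\notin Y$) is represented by the total map $\delta_{\overline Y}$ with $\delta_{\overline Y}(p)=\delta_Y(p-1)$ if $p-1\in\mathrm{dom}(\delta_Y)$ and $\delta_{\overline Y}(p)=\bot$ otherwise, where $p-1\in\mathbb N^{\mathbb N}\cup\mathbb N^*$ is the concatenation of $p(0)-1,p(1)-1,\dots$ and $0-1$ is the empty word. $X^{\mathbb N}$ is represented by $\langle p_0,p_1,\dots\rangle\mapsto(\delta_X(p_n))_n$,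 where $\langle p_0,p_1,\dots\rangle\langle n,k\rangle:=p_n(k)$ and $\langle n,k\rangle:=\frac12(n+k)(n+k+1)+k$ for $n,k\in\mathbb N$. For $f:\subseteq X\rightrightarrows Y$: the parallelization $\Pi f:\subseteq X^{\mathbb N}\rightrightarrows Y^{\mathbb N}$ has domain $\mathrm{dom}(f)^{\mathbb N}$ and $\Pi f((x_n)_n)=\{(y_n)_n:(\forall n)\ y_n\in f(x_n)\}$; the stashing $\Sigma f:\subseteq X^{\mathbb N}\rightrightarrows\overline Y^{\mathbb N}$ has domain $\mathrm{dom}(f)^{\mathbb N}$ and $\Sigma f((x_n)_n)=\{(y_n)_n\in\overline Y^{\mathbb N}:(\exists n)\ y_n\in f(x_n)\}$. Words such as $\Pi\Sigma f$ denote iterated application, $\Pi\Sigma f=\Pi(\Sigma f)$. *)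

theory Defs
  imports "HOL-Library.Infinite_Set" "HOL-Library.Nat_Bijection"
begin

section \<open>Computable functions on Baire space\<close>

text \<open>
  A partial function \<open>F\<close> on Baire space is computable if a single oracle program computes
  \<open>n \<mapsto> F(p)(n)\<close> from the oracle \<open>p\<close>, for all \<open>p \<in> dom(F)\<close>. The programs are Kleene's schemes for
  partial recursive functions, relativised to an oracle. A call with too few arguments
  (or, for \<open>Succ\<close> and \<open>Oracle\<close>, with more than one) is undefined.
\<close>

datatype prog =
    Zero
  | Succ
  | Proj nat
  | Oracle
  | Comp prog "prog list"
  | PrimRec prog prog
  | Mu prog

fun run :: "prog \<Rightarrow> (nat \<Rightarrow> nat) \<Rightarrow> nat list \<Rightarrow> nat option" where
  "run Zero p xs = Some 0"
| "run Succ p xs = (case xs of [x] \<Rightarrow> Some (Suc x) | _ \<Rightarrow> None)"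
| "run (Proj i) p xs = (if i < length xs then Some (xs ! i) else None)"
| "run Oracle p xs = (case xs of [x] \<Rightarrow> Some (p x) | _ \<Rightarrow> None)"
| "run (Comp f gs) p xs = Option.bind (those (map (\<lambda>g. run g p xs) gs)) (run f p)"
| "run (PrimRec f g) p xs =
     (case xs of
        [] \<Rightarrow> None
      | n # ys \<Rightarrow>
          rec_nat (run f p ys) (\<lambda>m r. Option.bind r (\<lambda>v. run g p (m # v # ys))) n)"
| "run (Mu f) p xs =
     (if \<exists>n. run f p (n # xs) = Some 0 \<and> (\<forall>m<n. \<exists>v. run f p (m # xs) = Some (Suc v))
      then Some (LEAST n. run f p (n # xs) = Some 0) else None)"

text \<open>
  As usual in computable analysis, nothing is required of the program on oracles outside
  \<open>dom(F)\<close>; so restrictions of computable functions are computable.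
\<close>

definition computable :: "((nat \<Rightarrow> nat) \<rightharpoonup> (nat \<Rightarrow> nat)) \<Rightarrow> bool" where
  "computable F \<longleftrightarrow> (\<exists>e. \<forall>p q. F p = Some q \<longrightarrow> (\<forall>n. run e p [n] = Some (q n)))"


section \<open>Represented spaces\<close>

record 'a rspace =
  points :: "'a set"
  rep :: "(nat \<Rightarrow> nat) \<rightharpoonup> 'a"

definition represented_space :: "'a rspace \<Rightarrow> bool" where
  "represented_space X \<longleftrightarrow> ran (rep X) = points X"

definition cpair :: "nat \<Rightarrow> nat \<Rightarrow> nat" where
  "cpair n k = (n + k) * (n + k + 1) div 2 + k"

text \<open>
  \<open>p = \<langle>p\<^sub>0, p\<^sub>1, \<dots>\<rangle>\<close> holds iff \<open>p\<^sub>n = component p n\<close> for all \<open>n\<close>, since \<open>cpair\<close> is a bijection.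
\<close>

definition component :: "(nat \<Rightarrow> nat) \<Rightarrow> nat \<Rightarrow> nat \<Rightarrow> nat" where
  "component p n k = p (cpair n k)"

definition sequences :: "'a rspace \<Rightarrow> (nat \<Rightarrow> 'a) rspace" where
  "sequences X =
     \<lparr>points = {x. \<forall>n. x n \<in> points X},
      rep = (\<lambda>p. if \<forall>n. component p n \<in> dom (rep X)
                 then Some (\<lambda>n. the (rep X (component p n))) else None)\<rparr>"

text \<open>
  The word \<open>p - 1\<close> arises from \<open>p\<close> by deleting all zeros and decreasing the remaining entries by
  one. It is infinite iff \<open>p\<close> has infinitely many nonzero entries. Finite words are never names,
  so they are all identified with \<open>None\<close>.
\<close>

definition minus_one :: "(nat \<Rightarrow> nat) \<Rightarrow> (nat \<Rightarrow> nat) option" where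
  "minus_one p =
     (if infinite {i. p i \<noteq> 0} then Some (\<lambda>k. p (enumerate {i. p i \<noteq> 0} k) - 1) else None)"

text \<open>The point \<open>\<bottom>\<close> of the completion is \<open>None\<close>; the representation of the completion is total.\<close>

definition completion :: "'a rspace \<Rightarrow> 'a option rspace" where
  "completion Y =
     \<lparr>points = insert None (Some ` points Y),
      rep = (\<lambda>p. Some (Option.bind (minus_one p) (rep Y)))\<rparr>"


section \<open>Problems and strong Weihrauch reducibility\<close>

text \<open>
  A partial multivalued function is given by its values; its domain is the set of points with a
  nonempty value. (Any function with a realizer has nonempty values throughout its domain.)
\<close>

record ('a, 'b) multimap =
  source :: "'a rspace"
  target :: "'b rspace"
  vals :: "'a \<Rightarrow> 'b set"

definition mdom :: "('a, 'b) multimap \<Rightarrow> 'a set" where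
  "mdom f = {x. vals f x \<noteq> {}}"

definition realizer :: "((nat \<Rightarrow> nat) \<rightharpoonup> (nat \<Rightarrow> nat)) \<Rightarrow> ('a, 'b) multimap \<Rightarrow> bool" where
  "realizer F f \<longleftrightarrow>
     (\<forall>p x. rep (source f) p = Some x \<and> x \<in> mdom f \<longrightarrow>
        (\<exists>q y. F p = Some q \<and> rep (target f) q = Some y \<and> y \<in> vals f x))"

definition problem :: "('a, 'b) multimap \<Rightarrow> bool" where
  "problem f \<longleftrightarrow>
     represented_space (source f) \<and> represented_space (target f) \<and>
     mdom f \<subseteq> points (source f) \<and> (\<forall>x. vals f x \<subseteq> points (target f)) \<and>
     (\<exists>F. realizer F f)"

definition sW_le :: "('a, 'b) multimap \<Rightarrow> ('c, 'd) multimap \<Rightarrow> bool"  (infix "\<le>\<^sub>s\<^sub>W" 50) where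
  "f \<le>\<^sub>s\<^sub>W g \<longleftrightarrow>
     (\<exists>H K. computable H \<and> computable K \<and>
        (\<forall>G. realizer G g \<longrightarrow> realizer (H \<circ>\<^sub>m (G \<circ>\<^sub>m K)) f))"

definition sW_equiv :: "('a, 'b) multimap \<Rightarrow> ('c, 'd) multimap \<Rightarrow> bool"  (infix "\<equiv>\<^sub>s\<^sub>W" 50) where
  "f \<equiv>\<^sub>s\<^sub>W g \<longleftrightarrow> f \<le>\<^sub>s\<^sub>W g \<and> g \<le>\<^sub>s\<^sub>W f"

definition parallelization :: "('a, 'b) multimap \<Rightarrow> (nat \<Rightarrow> 'a, nat \<Rightarrow> 'b) multimap" where
  "parallelization f =
     \<lparr>source = sequences (source f),
      target = sequences (target f),
      vals = (\<lambda>x. {y. (\<forall>n. x n \<in> mdom f) \<and> (\<forall>n. y n \<in> vals f (x n))})\<rparr>"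

definition stashing :: "('a, 'b) multimap \<Rightarrow> (nat \<Rightarrow> 'a, nat \<Rightarrow> 'b option) multimap" where
  "stashing f =
     \<lparr>source = sequences (source f),
      target = sequences (completion (target f)),
      vals = (\<lambda>x. {y \<in> points (sequences (completion (target f))).
                     (\<forall>n. x n \<in> mdom f) \<and> (\<exists>n. y n \<in> Some ` vals f (x n))})\<rparr>"


section \<open>Well-definedness\<close>

lemma cpair_eq: "cpair n k = prod_encode (k, n)"
  by (simp add: cpair_def prod_encode_def triangle_def add.commute)

lemma cpair_bij: "bij (\<lambda>(n, k). cpair n k)"
proof -
  have "(\<lambda>(n, k). cpair n k) = prod_encode \<circ> prod.swap"
    by (auto simp: cpair_eq)
  then show ?thesis
    by (simp add: bij_comp bij_prod_encode)
qed

lemma ex_component: "\<exists>p. \<forall>n. component p n = ps n"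
proof
  show "\<forall>n. component (\<lambda>i. ps (snd (prod_decode i)) (fst (prod_decode i))) n = ps n"
    by (auto simp: component_def cpair_eq)
qed

lemma minus_one_Suc: "minus_one (\<lambda>n. Suc (p n)) = Some p"
proof -
  have "enumerate (UNIV :: nat set) k = k" for k
    by (induction k) (auto simp: enumerate_0 enumerate_Suc'' intro: Least_equality)
  then show ?thesis
    by (simp add: minus_one_def)
qed

lemma ran_iff: "y \<in> ran m \<longleftrightarrow> (\<exists>a. m a = Some y)"
  by (simp add: ran_def)

lemma represented_space_sequences:
  assumes "represented_space X"
  shows "represented_space (sequences X)"
proof -
  have "x \<in> ran (rep (sequences X))" if x: "x \<in> points (sequences X)" for x
  proof -
    have "\<forall>n. \<exists>q. rep X q = Some (x n)"
      using assms x by (auto simp: represented_space_def sequences_def ran_def)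
    then obtain ps where ps: "\<And>n. rep X (ps n) = Some (x n)"
      by metis
    obtain p where "\<And>n. component p n = ps n"
      using ex_component by blast
    then have "rep (sequences X) p = Some x"
      by (auto simp: sequences_def ps dom_def)
    then show ?thesis
      unfolding ran_iff by blast
  qed
  moreover have "x \<in> points (sequences X)" if x: "x \<in> ran (rep (sequences X))" for x
  proof -
    obtain p where p: "rep (sequences X) p = Some x"
      using x unfolding ran_iff by blast
    then have "component p n \<in> dom (rep X)" "x n = the (rep X (component p n))" for n
      by (auto simp: sequences_def split: if_splits)
    then have "rep X (component p n) = Some (x n)" for n
      by (simp add: domIff)
    then have "x n \<in> ran (rep X)" for n
      unfolding ran_iff by blast
    then show ?thesis
      using assms by (simp add: represented_space_def sequences_def)
  qed
  ultimately show ?thesis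
    by (auto simp: represented_space_def)
qed

lemma represented_space_completion:
  assumes "represented_space Y"
  shows "represented_space (completion Y)"
proof -
  have "Some y \<in> ran (rep (completion Y))" if y: "y \<in> points Y" for y
  proof -
    obtain q where "rep Y q = Some y"
      using assms y unfolding represented_space_def by (metis ran_iff)
    then have "rep (completion Y) (\<lambda>n. Suc (q n)) = Some (Some y)"
      by (simp add: completion_def minus_one_Suc)
    then show ?thesis
      unfolding ran_iff by blast
  qed
  moreover have "rep (completion Y) (\<lambda>_. 0) = Some None"
    by (simp add: completion_def minus_one_def)
  then have "None \<in> ran (rep (completion Y))"
    unfolding ran_iff by blast
  moreover have "ran (rep (completion Y)) \<subseteq> points (completion Y)"
  proof
    fix z
    assume "z \<in> ran (rep (completion Y))"
    then obtain p where p: "z = Option.bind (minus_one p) (rep Y)"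
      unfolding ran_iff by (auto simp: completion_def)
    show "z \<in> points (completion Y)"
    proof (cases z)
      case None
      then show ?thesis
        by (simp add: completion_def)
    next
      case (Some y)
      then obtain q where "rep Y q = Some y"
        using p by (metis bind_eq_Some_conv)
      then have "y \<in> points Y"
        using assms unfolding represented_space_def by (metis ran_iff)
      then show ?thesis
        using Some by (simp add: completion_def)
    qed
  qed
  ultimately show ?thesis
    by (auto simp: represented_space_def completion_def)
qed

lemma ex_realizer:
  assumes "represented_space (target f)" and "\<And>x. vals f x \<subseteq> points (target f)"
  shows "\<exists>F. realizer F f"
proof -
  have "\<exists>q y. rep (target f) q = Some y \<and> y \<in> vals f x" if "x \<in> mdom f" for x
    using assms that by (fastforce simp: represented_space_def mdom_def ran_def)
  then obtain Q where "\<And>x. x \<in> mdom f \<Longrightarrow> \<exists>y. rep (target f) (Q x) = Some y \<and> y \<in> vals f x"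
    by metis
  then have "realizer (\<lambda>p. map_option Q (rep (source f) p)) f"
    by (auto simp: realizer_def)
  then show ?thesis
    by blast
qed

lemma mdom_parallelization:
  fixes f :: "('a, 'b) multimap"
  shows "mdom (parallelization f) = {x. \<forall>n. x n \<in> mdom f}"
proof -
  have "\<exists>y. \<forall>n. y n \<in> vals f (x n)" if "\<forall>n. vals f (x n) \<noteq> {}" for x :: "nat \<Rightarrow> 'a"
    using that by (intro choice) blast
  then show ?thesis
    by (auto simp: mdom_def parallelization_def)
qed

lemma mdom_stashing:
  assumes "problem f"
  shows "mdom (stashing f) = {x. \<forall>n. x n \<in> mdom f}"
proof -
  have "vals (stashing f) x \<noteq> {}" if x: "\<forall>n. x n \<in> mdom f" for x
  proof -
    obtain z where z: "z \<in> vals f (x 0)"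
      using x by (auto simp: mdom_def)
    have "z \<in> points (target f)"
      using assms z by (auto simp: problem_def)
    then have "(\<lambda>_. Some z) \<in> vals (stashing f) x"
      using x z by (auto simp: stashing_def sequences_def completion_def)
    then show ?thesis
      by blast
  qed
  then show ?thesis
    by (auto simp: mdom_def stashing_def)
qed

lemma problem_parallelization:
  assumes "problem f"
  shows "problem (parallelization f)"
proof -
  have 1: "represented_space (source (parallelization f))"
    "represented_space (target (parallelization f))"
    using assms by (simp_all add: problem_def parallelization_def represented_space_sequences)
  have 2: "vals (parallelization f) x \<subseteq> points (target (parallelization f))" for x
    using assms by (fastforce simp: problem_def parallelization_def sequences_def)
  have "mdom (parallelization f) \<subseteq> points (source (parallelization f))"
    using assms by (auto simp: mdom_parallelization problem_def)
       (auto simp: parallelization_def sequences_def)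
  then show ?thesis
    using 1 2 ex_realizer[OF 1(2) 2] by (simp add: problem_def)
qed

lemma problem_stashing:
  assumes "problem f"
  shows "problem (stashing f)"
proof -
  have 1: "represented_space (source (stashing f))" "represented_space (target (stashing f))"
    using assms
    by (simp_all add: problem_def stashing_def represented_space_sequences
          represented_space_completion)
  have 2: "vals (stashing f) x \<subseteq> points (target (stashing f))" for x
    by (auto simp: stashing_def)
  have "mdom (stashing f) \<subseteq> points (source (stashing f))"
    using assms by (auto simp: mdom_stashing problem_def)
       (auto simp: stashing_def sequences_def)
  then show ?thesis
    using 1 2 ex_realizer[OF 1(2) 2] by (simp add: problem_def)
qed

end

theory Submission
  imports Defs
begin

text \<open>
  All reductions permute the inputs and read the required output off the answer. The only delicate
  point is to rearrange the word \<open>p - 1\<close> coded by a name \<open>p\<close> of a point of a completion, although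
  this word may be finite and its length is not computable: the rearranged word is
  produced letter by letter, with a padding zero whenever the next letter has not yet been read.
  For (1), the question \<open>(x\<^sub>n\<^sub>m)\<close> is transposed: if the \<open>m\<close>-th answer of the stashing is right, it
  contains a right answer to \<open>x\<^sub>n\<^sub>m\<close> for every \<open>n\<close> at once. In (2) and (3), one direction is an
  instance of \<open>g \<le> \<Pi>g\<close> or \<open>\<Sigma>g \<le> g\<close>, and the other is the transposition of (1), with inner sequences
  paired up in (2) and the index of \<open>\<Sigma>f\<close> split into a pair in (3).
\<close>

section \<open>Total computable operations\<close>

text \<open>Totality for every oracle and every argument list of length \<open>k\<close> lets such
  operations be composed without tracking undefinedness.\<close>

definition computable_op :: "nat \<Rightarrow> ((nat \<Rightarrow> nat) \<Rightarrow> nat list \<Rightarrow> nat) \<Rightarrow> bool" where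
  "computable_op k \<phi> \<longleftrightarrow> (\<exists>e. \<forall>p xs. length xs = k \<longrightarrow> run e p xs = Some (\<phi> p xs))"

lemma computable_opI:
  "(\<And>p xs. length xs = k \<Longrightarrow> run e p xs = Some (\<phi> p xs)) \<Longrightarrow> computable_op k \<phi>"
  by (auto simp: computable_op_def)

lemma those_map_Some: "those (map (\<lambda>x. Some (f x)) xs) = Some (map f xs)"
  by (induction xs) auto

text \<open>\<open>Comp\<close> passes on no arguments by itself, so projections hand them over: all
  of them (\<open>d = 0\<close>) to a primitive recursion, the last \<open>k\<close>
  (\<open>d = 2\<close>) within its step.\<close>

lemma those_run_Proj:
  assumes "length xs = d + k"
  shows "those (map (\<lambda>g. run g p xs) (map Proj [d..<d + k])) = Some (drop d xs)"
proof -
  have "map (\<lambda>g. run g p xs) (map Proj [d..<d + k]) = map (\<lambda>i. Some (xs ! i)) [d..<d + k]"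
    using assms by simp
  moreover have "map ((!) xs) [d..<d + k] = drop d xs"
    using assms by (intro nth_equalityI) auto
  ultimately show ?thesis
    by (simp only: those_map_Some)
qed

lemma computable_op_nth: "i < k \<Longrightarrow> computable_op k (\<lambda>p xs. xs ! i)"
  by (rule computable_opI[where e = "Proj i"]) simp

lemma computable_op_Suc:
  assumes "computable_op k a"
  shows "computable_op k (\<lambda>p xs. Suc (a p xs))"
proof -
  obtain e where "\<And>p xs. length xs = k \<Longrightarrow> run e p xs = Some (a p xs)"
    using assms unfolding computable_op_def by blast
  then show ?thesis
    by (intro computable_opI[where e = "Comp Succ [e]"]) simp
qed

lemma computable_op_oracle:
  assumes "computable_op k a"
  shows "computable_op k (\<lambda>p xs. p (a p xs))"
proof -
  obtain e where "\<And>p xs. length xs = k \<Longrightarrow> run e p xs = Some (a p xs)"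
    using assms unfolding computable_op_def by blast
  then show ?thesis
    by (intro computable_opI[where e = "Comp Oracle [e]"]) simp
qed

lemma computable_op_const: "computable_op k (\<lambda>p xs. c)"
proof (induction c)
  case 0
  show ?case
    by (rule computable_opI[where e = Zero]) simp
qed (rule computable_op_Suc)

text \<open>In the step of a primitive recursion the counter and the previous value precede the
  parameters; this rule skips those two arguments.\<close>

lemma computable_op_drop:
  assumes "computable_op k a"
  shows "computable_op (Suc (Suc k)) (\<lambda>p xs. a p (drop 2 xs))"
proof -
  obtain e where e: "\<And>p xs. length xs = k \<Longrightarrow> run e p xs = Some (a p xs)"
    using assms unfolding computable_op_def by blast
  show ?thesis
  proof (rule computable_opI[where e = "Comp e (map Proj [2..<2 + k])"])
    fix p and xs :: "nat list"
    assume "length xs = Suc (Suc k)"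
    then show "run (Comp e (map Proj [2..<2 + k])) p xs = Some (a p (drop 2 xs))"
      using those_run_Proj[of xs 2 k p] e by (simp del: map_map)
  qed
qed

text \<open>Giving \<open>F\<close> by its recursion equations lets one rule serve recursive
  constants such as \<open>triangle\<close> as well as closed expressions such as
  \<open>a p xs + m\<close>.\<close>

lemma computable_op_rec:
  assumes F_0: "\<And>p xs. F p xs 0 = a p xs"
    and F_Suc: "\<And>p xs m. F p xs (Suc m) = g p xs m (F p xs m)"
    and n: "computable_op k n"
    and a: "computable_op k a"
    and g: "computable_op (Suc (Suc k)) (\<lambda>p ys. g p (drop 2 ys) (ys ! 0) (ys ! 1))"
  shows "computable_op k (\<lambda>p xs. F p xs (n p xs))"
proof -
  obtain en where en: "\<And>p xs. length xs = k \<Longrightarrow> run en p xs = Some (n p xs)"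
    using n unfolding computable_op_def by blast
  obtain ea where ea: "\<And>p xs. length xs = k \<Longrightarrow> run ea p xs = Some (a p xs)"
    using a unfolding computable_op_def by blast
  obtain eg where eg: "\<And>p ys. length ys = Suc (Suc k) \<Longrightarrow>
      run eg p ys = Some (g p (drop 2 ys) (ys ! 0) (ys ! 1))"
    using g unfolding computable_op_def by blast
  show ?thesis
  proof (rule computable_opI[where e = "Comp (PrimRec ea eg) (en # map Proj [0..<0 + k])"])
    fix p and xs :: "nat list"
    assume len: "length xs = k"
    have "rec_nat (run ea p xs) (\<lambda>m r. Option.bind r (\<lambda>v. run eg p (m # v # xs))) m
        = Some (F p xs m)" for m
      by (induction m) (simp_all add: F_0 F_Suc ea eg len)
    then show "run (Comp (PrimRec ea eg) (en # map Proj [0..<0 + k])) p xs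
        = Some (F p xs (n p xs))"
      using those_run_Proj[of xs 0 k p] en len by (simp del: map_map)
  qed
qed

section \<open>Closure under arithmetic and case distinction\<close>

named_theorems computable_intros

lemmas [computable_intros] =
  computable_op_nth computable_op_Suc computable_op_oracle computable_op_const

lemma computable_op_add [computable_intros]:
  assumes "computable_op k a" "computable_op k b"
  shows "computable_op k (\<lambda>p xs. a p xs + b p xs)"
  by (rule computable_op_rec[where F = "\<lambda>p xs m. a p xs + m" and a = a
        and g = "\<lambda>p xs m v. Suc v", OF _ _ assms(2,1)])
    (auto intro!: computable_intros)

text \<open>The recursion step returns its counter, which is the predecessor of the argument
  reached.\<close>

lemma computable_op_pred:
  assumes "computable_op k a"
  shows "computable_op k (\<lambda>p xs. a p xs - Suc 0)"
  by (rule computable_op_rec[where F = "\<lambda>p xs m. m - Suc 0" and a = "\<lambda>_ _. 0"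
        and g = "\<lambda>p xs m v. m", OF _ _ assms])
    (auto intro!: computable_intros)

lemma computable_op_diff [computable_intros]:
  assumes "computable_op k a" "computable_op k b"
  shows "computable_op k (\<lambda>p xs. a p xs - b p xs)"
  by (rule computable_op_rec[where F = "\<lambda>p xs m. a p xs - m" and a = a
        and g = "\<lambda>p xs m v. v - Suc 0", OF _ _ assms(2,1)])
    (auto intro!: computable_intros computable_op_pred)

text \<open>A recursion whose step ignores both the counter and the previous value is a case
  distinction.\<close>

lemma computable_op_if_zero:
  assumes "computable_op k a" "computable_op k b" "computable_op k c"
  shows "computable_op k (\<lambda>p xs. if a p xs = 0 then b p xs else c p xs)"
  by (rule computable_op_rec[where F = "\<lambda>p xs m. if m = 0 then b p xs else c p xs" and a = b
        and g = "\<lambda>p xs m v. c p xs", OF _ _ assms(1,2)])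
    (auto intro!: computable_intros computable_op_drop assms)

lemma computable_op_if_le [computable_intros]:
  assumes "computable_op k a" "computable_op k b" "computable_op k c" "computable_op k d"
  shows "computable_op k (\<lambda>p xs. if a p xs \<le> b p xs then c p xs else d p xs)"
  using computable_op_if_zero[OF computable_op_diff[OF assms(1,2)] assms(3,4)] by simp

lemma computable_op_if_eq [computable_intros]:
  assumes "computable_op k a" "computable_op k b" "computable_op k c" "computable_op k d"
  shows "computable_op k (\<lambda>p xs. if a p xs = b p xs then c p xs else d p xs)"
proof -
  \<comment> \<open>Truncated subtraction detects only one inequality, so equality is tested by both
    differences.\<close>
  have "(a p xs - b p xs) + (b p xs - a p xs) = 0 \<longleftrightarrow> a p xs = b p xs" for p xs
    by auto
  then show ?thesis
    using computable_op_if_zero[OF computable_op_add[OF computable_op_diff[OF assms(1,2)]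
          computable_op_diff[OF assms(2,1)]] assms(3,4)] by simp
qed

section \<open>Cantor pairing\<close>

lemma computable_op_triangle [computable_intros]:
  assumes "computable_op k a"
  shows "computable_op k (\<lambda>p xs. triangle (a p xs))"
  by (rule computable_op_rec[where F = "\<lambda>p xs. triangle" and a = "\<lambda>_ _. 0"
        and g = "\<lambda>p xs m v. v + Suc m", OF _ _ assms])
    (auto intro!: computable_intros)

lemma cpair_triangle: "cpair n k = triangle (n + k) + k"
  by (simp add: cpair_eq prod_encode_def add.commute)

lemma computable_op_cpair [computable_intros]:
  assumes "computable_op k a" "computable_op k b"
  shows "computable_op k (\<lambda>p xs. cpair (a p xs) (b p xs))"
  unfolding cpair_triangle by (intro computable_intros assms)

text \<open>\<open>cpair\<close> is \<open>prod_encode\<close> with swapped arguments, so its first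
  coordinate is decoded by \<open>snd\<close>.\<close>

definition cfst :: "nat \<Rightarrow> nat" where
  "cfst z = snd (prod_decode z)"

definition csnd :: "nat \<Rightarrow> nat" where
  "csnd z = fst (prod_decode z)"

lemma cfst_cpair [simp]: "cfst (cpair n k) = n"
  by (simp add: cfst_def cpair_eq)

lemma csnd_cpair [simp]: "csnd (cpair n k) = k"
  by (simp add: csnd_def cpair_eq)

text \<open>The diagonal of the Cantor enumeration that contains \<open>z\<close>, which is the sum
  of the coordinates of \<open>z\<close>. One step in \<open>z\<close> moves at most one diagonal
  further, so primitive recursion suffices.\<close>

fun diagonal :: "nat \<Rightarrow> nat" where
  "diagonal 0 = 0"
| "diagonal (Suc z) =
     (if triangle (Suc (diagonal z)) \<le> Suc z then Suc (diagonal z) else diagonal z)"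

lemma diagonal_bounds: "triangle (diagonal z) \<le> z \<and> z < triangle (Suc (diagonal z))"
  by (induction z) auto

text \<open>The offset of \<open>z\<close> on its diagonal is one coordinate and the rest of the
  diagonal index the other, so decoding is computable by subtraction.\<close>

lemma prod_decode_diagonal:
  "prod_decode z = (z - triangle (diagonal z), diagonal z - (z - triangle (diagonal z)))"
proof -
  have "prod_encode (z - triangle (diagonal z), diagonal z - (z - triangle (diagonal z))) = z"
    using diagonal_bounds[of z] by (auto simp: prod_encode_def)
  then show ?thesis
    by (metis prod_encode_inverse)
qed

lemma computable_op_diagonal [computable_intros]:
  assumes "computable_op k a"
  shows "computable_op k (\<lambda>p xs. diagonal (a p xs))"
  by (rule computable_op_rec[where F = "\<lambda>p xs. diagonal" and a = "\<lambda>_ _. 0"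
        and g = "\<lambda>p xs m v. if triangle (Suc v) \<le> Suc m then Suc v else v", OF _ _ assms])
    (auto intro!: computable_intros simp del: triangle_Suc)

lemma computable_op_csnd [computable_intros]:
  assumes "computable_op k a"
  shows "computable_op k (\<lambda>p xs. csnd (a p xs))"
  unfolding csnd_def prod_decode_diagonal fst_conv by (intro computable_intros assms)

lemma computable_op_cfst [computable_intros]:
  assumes "computable_op k a"
  shows "computable_op k (\<lambda>p xs. cfst (a p xs))"
  unfolding cfst_def prod_decode_diagonal snd_conv by (intro computable_intros assms)

section \<open>Rearranging the word of a name in the completion\<close>

fun letters_read :: "(nat \<Rightarrow> nat) \<Rightarrow> nat \<Rightarrow> nat" where
  "letters_read p 0 = 0"
| "letters_read p (Suc i) = (if p i = 0 then letters_read p i else Suc (letters_read p i))"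

text \<open>
  Zero as long as the \<open>c\<close>-th letter of \<open>p - 1\<close> has not been read, and the successor of that
  letter afterwards.
\<close>

fun letter :: "(nat \<Rightarrow> nat) \<Rightarrow> nat \<Rightarrow> nat \<Rightarrow> nat" where
  "letter p c 0 = 0"
| "letter p c (Suc i) =
     (if p i = 0 then letter p c i else if letters_read p i = c then p i else letter p c i)"

text \<open>The number of letters output so far is also the position of the next one, so
  \<open>\<sigma>\<close> of it is the letter to request from \<open>p - 1\<close>. Only entries of
  \<open>p\<close> before the current stage are inspected, so no stage waits.\<close>

fun letters_written :: "(nat \<Rightarrow> nat) \<Rightarrow> (nat \<Rightarrow> nat) \<Rightarrow> nat \<Rightarrow> nat" where
  "letters_written p \<sigma> 0 = 0"
| "letters_written p \<sigma> (Suc i) =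
     (if letter p (\<sigma> (letters_written p \<sigma> i)) i = 0 then letters_written p \<sigma> i
      else Suc (letters_written p \<sigma> i))"

definition rearrange :: "(nat \<Rightarrow> nat) \<Rightarrow> (nat \<Rightarrow> nat) \<Rightarrow> nat \<Rightarrow> nat" where
  "rearrange p \<sigma> s = letter p (\<sigma> (letters_written p \<sigma> s)) s"

section \<open>Correctness of the rearrangement\<close>

lemma letters_read_card: "letters_read p s = card {i \<in> {i. p i \<noteq> 0}. i < s}"
proof (induction s)
  case (Suc s)
  have "{i \<in> {i. p i \<noteq> 0}. i < Suc s} =
      (if p s = 0 then {i \<in> {i. p i \<noteq> 0}. i < s} else insert s {i \<in> {i. p i \<noteq> 0}. i < s})"
    by (auto simp: less_Suc_eq)
  then show ?case
    using Suc by simp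
qed simp

lemma card_below_enumerate:
  fixes S :: "nat set"
  assumes "infinite S"
  shows "card {i \<in> S. i < enumerate S k} = k"
proof -
  have "{i \<in> S. i < enumerate S k} = enumerate S ` {..<k}"
  proof (intro equalityI subsetI)
    fix i
    assume i: "i \<in> {i \<in> S. i < enumerate S k}"
    then obtain j where "i = enumerate S j"
      using assms by (metis (no_types, lifting) enumerate_Ex mem_Collect_eq)
    then show "i \<in> enumerate S ` {..<k}"
      using i assms by (auto simp: enumerate_mono_iff)
  qed (use assms in \<open>auto simp: enumerate_in_set enumerate_mono\<close>)
  moreover have "inj_on (enumerate S) {..<k}"
    using assms by (metis inj_enumerate inj_on_subset subset_UNIV)
  ultimately show ?thesis
    by (simp add: card_image)
qed

text \<open>A nonzero entry is letter number \<open>k\<close> exactly when \<open>k\<close> nonzero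
  entries precede it. Trading \<open>enumerate\<close> for this count allows induction over
  stages.\<close>

lemma minus_one_eq_Some:
  "minus_one p = Some q \<longleftrightarrow>
     infinite {i. p i \<noteq> 0} \<and> (\<forall>i. p i \<noteq> 0 \<longrightarrow> p i = Suc (q (letters_read p i)))"
proof (cases "infinite {i. p i \<noteq> 0}")
  case inf: True
  let ?e = "enumerate {i. p i \<noteq> 0}"
  have read: "letters_read p (?e k) = k" for k
    using card_below_enumerate[OF inf] by (simp add: letters_read_card)
  have nonzero: "p (?e k) \<noteq> 0" for k
    using enumerate_in_set[OF inf] by blast
  have enum: "\<exists>k. i = ?e k" if "p i \<noteq> 0" for i
    using enumerate_Ex[OF inf, of i] that by (metis mem_Collect_eq)
  have "minus_one p = Some q \<longleftrightarrow> (\<forall>k. p (?e k) - 1 = q k)"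
    using inf by (simp add: minus_one_def fun_eq_iff)
  also have "\<dots> \<longleftrightarrow> (\<forall>k. p (?e k) = Suc (q k))"
    using nonzero by (metis Suc_pred diff_Suc_1 not_gr_zero)
  also have "\<dots> \<longleftrightarrow> (\<forall>i. p i \<noteq> 0 \<longrightarrow> p i = Suc (q (letters_read p i)))"
  proof (intro iffI allI impI)
    fix i
    assume "\<forall>k. p (?e k) = Suc (q k)" "p i \<noteq> 0"
    then show "p i = Suc (q (letters_read p i))"
      using enum[of i] read by auto
  next
    fix k
    assume "\<forall>i. p i \<noteq> 0 \<longrightarrow> p i = Suc (q (letters_read p i))"
    then show "p (?e k) = Suc (q k)"
      using read[of k] nonzero[of k] by metis
  qed
  finally show ?thesis
    using inf by simp
qed (simp add: minus_one_def)

lemma ex_letters_read: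
  assumes "minus_one p = Some q"
  shows "\<exists>i. p i \<noteq> 0 \<and> letters_read p i = c"
proof -
  have inf: "infinite {i. p i \<noteq> 0}"
    using assms by (simp add: minus_one_eq_Some)
  show ?thesis
    using card_below_enumerate[OF inf, of c] enumerate_in_set[OF inf, of c]
    by (auto simp: letters_read_card)
qed

lemma letter_eq:
  assumes "minus_one p = Some q" "letter p c s \<noteq> 0"
  shows "letter p c s = Suc (q c)"
  using assms(2) by (induction s) (use assms(1) in \<open>auto simp: minus_one_eq_Some split: if_splits\<close>)

text \<open>Once set, the value is only ever overwritten by nonzero entries.\<close>

lemma letter_nonzero: "p i \<noteq> 0 \<Longrightarrow> letters_read p i = c \<Longrightarrow> i < s \<Longrightarrow> letter p c s \<noteq> 0"
  by (induction s) (auto simp: less_Suc_eq)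

lemma letters_read_rearrange: "letters_read (rearrange p \<sigma>) s = letters_written p \<sigma> s"
  by (induction s) (simp_all add: rearrange_def)

text \<open>Every requested letter of an infinite word eventually arrives, so the output cannot
  stall; and since the output's letter count is \<open>letters_written\<close>, its letter number
  \<open>k\<close> is the one requested at \<open>\<sigma> k\<close>.\<close>

lemma minus_one_rearrange:
  assumes p: "minus_one p = Some q"
  shows "minus_one (rearrange p \<sigma>) = Some (q \<circ> \<sigma>)"
proof -
  have "\<exists>t\<ge>s. rearrange p \<sigma> t \<noteq> 0" for s
  proof (rule ccontr)
    assume "\<not> ?thesis"
    then have zero: "rearrange p \<sigma> t = 0" if "t \<ge> s" for t
      using that by blast
    \<comment> \<open>While only zeros are written, the request stays fixed.\<close>
    have written: "letters_written p \<sigma> t = letters_written p \<sigma> s" if "t \<ge> s" for t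
      using that
    proof (induction t rule: dec_induct)
      case (step t)
      then show ?case
        using zero[of t] by (simp add: rearrange_def)
    qed simp
    obtain i where i: "p i \<noteq> 0" "letters_read p i = \<sigma> (letters_written p \<sigma> s)"
      using ex_letters_read[OF p] by blast
    \<comment> \<open>Stage \<open>?t\<close> inspects entries strictly below \<open>?t\<close>,
      hence \<open>Suc i\<close>; being at least \<open>s\<close>, it lies in the supposedly silent
      range.\<close>
    let ?t = "max s (Suc i)"
    have "rearrange p \<sigma> ?t = letter p (\<sigma> (letters_written p \<sigma> s)) ?t"
      by (simp only: rearrange_def written[OF max.cobounded1])
    then show False
      using letter_nonzero[OF i, of ?t] zero[of ?t] by simp
  qed
  then have "infinite {s. rearrange p \<sigma> s \<noteq> 0}"
    by (auto simp: infinite_nat_iff_unbounded_le)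
  then show ?thesis
    using letter_eq[OF p]
    by (auto simp: minus_one_eq_Some letters_read_rearrange) (simp add: rearrange_def)
qed

text \<open>Collapses two nested levels of completion.\<close>

lemma minus_one_pred:
  assumes p: "minus_one p = Some q" and q: "minus_one q = Some r"
  shows "minus_one (\<lambda>i. p i - 1) = Some r"
proof -
  let ?p' = "\<lambda>i. p i - 1"
  have p_eq: "p i - 1 = q (letters_read p i)" if "p i \<noteq> 0" for i
    using p that by (metis diff_Suc_1 minus_one_eq_Some)
  \<comment> \<open>Both kinds of padding become zero in \<open>?p'\<close>: an entry 0 of
    \<open>p\<close> by truncation, and an entry 1, which codes a zero of \<open>q\<close>.\<close>
  have "letters_read ?p' i = letters_read q (letters_read p i)" for i
  proof (induction i)
    case (Suc i)
    then show ?case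
      using p_eq[of i] by (cases "p i") auto
  qed simp
  moreover have "infinite {i. ?p' i \<noteq> 0}"
  proof
    assume "finite {i. ?p' i \<noteq> 0}"
    \<comment> \<open>Each nonzero entry of \<open>q\<close> is coded by an entry of
      \<open>p\<close> that survives the subtraction, so finiteness would carry over to
      \<open>q\<close>.\<close>
    moreover have "{c. q c \<noteq> 0} \<subseteq> letters_read p ` {i. ?p' i \<noteq> 0}"
    proof
      fix c
      assume c: "c \<in> {c. q c \<noteq> 0}"
      obtain i where "p i \<noteq> 0" "letters_read p i = c"
        using ex_letters_read[OF p] by blast
      then show "c \<in> letters_read p ` {i. ?p' i \<noteq> 0}"
        using p_eq[of i] c by auto
    qed
    ultimately show False
      using q finite_surj by (auto simp: minus_one_eq_Some)
  qed
  moreover have "?p' i = Suc (r (letters_read q (letters_read p i)))" if "?p' i \<noteq> 0" for i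
  proof -
    have "p i \<noteq> 0"
      using that by simp
    then show ?thesis
      using p_eq[of i] q that by (simp add: minus_one_eq_Some)
  qed
  ultimately show ?thesis
    by (simp add: minus_one_eq_Some)
qed

section \<open>Computability of the rearrangement of an oracle component\<close>

lemma computable_op_component [computable_intros]:
  assumes "computable_op k m" "computable_op k s"
  shows "computable_op k (\<lambda>p xs. component p (m p xs) (s p xs))"
  unfolding component_def by (intro computable_intros assms)

lemma computable_op_letters_read [computable_intros]:
  assumes "computable_op k m" "computable_op k s"
  shows "computable_op k (\<lambda>p xs. letters_read (component p (m p xs)) (s p xs))"
  by (rule computable_op_rec[where F = "\<lambda>p xs. letters_read (component p (m p xs))"
        and a = "\<lambda>_ _. 0" and g = "\<lambda>p xs i v. if component p (m p xs) i = 0 then v else Suc v",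
        OF _ _ assms(2)])
    (auto intro!: computable_intros computable_op_drop assms)

lemma computable_op_letter [computable_intros]:
  assumes "computable_op k m" "computable_op k c" "computable_op k s"
  shows "computable_op k (\<lambda>p xs. letter (component p (m p xs)) (c p xs) (s p xs))"
  by (rule computable_op_rec[where F = "\<lambda>p xs. letter (component p (m p xs)) (c p xs)"
        and a = "\<lambda>_ _. 0" and g = "\<lambda>p xs i v. if component p (m p xs) i = 0 then v else
          if letters_read (component p (m p xs)) i = c p xs then component p (m p xs) i else v",
        OF _ _ assms(3)])
    (auto intro!: computable_intros computable_op_drop assms)

text \<open>The hypothesis on \<open>\<sigma>\<close> covers all arities because
  \<open>\<sigma>\<close> is also evaluated inside a recursion step, with two more
  arguments.\<close>

lemma computable_op_rearrange:
  assumes \<sigma>: "\<And>k a b. computable_op k a \<Longrightarrow> computable_op k b \<Longrightarrow>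
      computable_op k (\<lambda>p xs. \<sigma> (a p xs) (b p xs))"
    and m: "computable_op k m" and n: "computable_op k n" and s: "computable_op k s"
  shows "computable_op k (\<lambda>p xs. rearrange (component p (m p xs)) (\<sigma> (n p xs)) (s p xs))"
proof -
  have "computable_op k
      (\<lambda>p xs. letters_written (component p (m p xs)) (\<sigma> (n p xs)) (s p xs))"
    by (rule computable_op_rec[
          where F = "\<lambda>p xs. letters_written (component p (m p xs)) (\<sigma> (n p xs))"
          and a = "\<lambda>_ _. 0" and g = "\<lambda>p xs i v.
            if letter (component p (m p xs)) (\<sigma> (n p xs) v) i = 0 then v else Suc v",
          OF _ _ s])
      (auto intro!: computable_intros computable_op_drop m n \<sigma>)
  then show ?thesis
    unfolding rearrange_def by (intro computable_intros m n s \<sigma>)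
qed

section \<open>Names of instances and of solutions\<close>

text \<open>Together with \<open>names_solution\<close> this splits \<open>realizer\<close> into
  question and answer, so reductions can be checked on names alone.\<close>

definition names_instance :: "('a, 'b) multimap \<Rightarrow> (nat \<Rightarrow> nat) \<Rightarrow> 'a \<Rightarrow> bool" where
  "names_instance f p x \<longleftrightarrow> rep (source f) p = Some x \<and> x \<in> mdom f"

definition names_solution :: "('a, 'b) multimap \<Rightarrow> (nat \<Rightarrow> nat) \<Rightarrow> 'a \<Rightarrow> bool" where
  "names_solution f q x \<longleftrightarrow> (\<exists>y. rep (target f) q = Some y \<and> y \<in> vals f x)"

lemma rep_sequences:
  "rep (sequences X) p = Some x \<longleftrightarrow> (\<forall>n. rep X (component p n) = Some (x n))"
proof (cases "\<forall>n. component p n \<in> dom (rep X)")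
  case True
  then have "rep X (component p n) = Some (x n) \<longleftrightarrow> the (rep X (component p n)) = x n" for n
    by (auto simp: dom_def) (metis option.sel)
  then show ?thesis
    using True by (auto simp: sequences_def fun_eq_iff)
next
  case False
  then show ?thesis
    by (auto simp: sequences_def domIff) (metis option.distinct(1))
qed

lemma names_instance_parallelization:
  "names_instance (parallelization f) p x \<longleftrightarrow> (\<forall>n. names_instance f (component p n) (x n))"
  unfolding names_instance_def mdom_parallelization
  by (auto simp: parallelization_def rep_sequences)

lemma names_instance_stashing:
  assumes "problem f"
  shows "names_instance (stashing f) p x \<longleftrightarrow> (\<forall>n. names_instance f (component p n) (x n))"
  unfolding names_instance_def mdom_stashing[OF assms]
  by (auto simp: stashing_def rep_sequences)

lemma names_solution_parallelization:
  "names_solution (parallelization f) q x \<longleftrightarrow> (\<forall>n. names_solution f (component q n) (x n))"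
proof
  assume "\<forall>n. names_solution f (component q n) (x n)"
  then obtain y where
    "\<And>n. rep (target f) (component q n) = Some (y n) \<and> y n \<in> vals f (x n)"
    unfolding names_solution_def by metis
  then show "names_solution (parallelization f) q x"
    by (auto simp: names_solution_def parallelization_def rep_sequences mdom_def)
qed (auto simp: names_solution_def parallelization_def rep_sequences)

text \<open>The completion has a total representation, so \<open>q\<close> names exactly one
  sequence. A right entry differs from \<open>None\<close>, so its word is infinite and a genuine
  name.\<close>

lemma names_solution_stashing:
  assumes f: "problem f" and x: "\<And>n. x n \<in> mdom f"
  shows "names_solution (stashing f) q x \<longleftrightarrow>
    (\<exists>n r. minus_one (component q n) = Some r \<and> names_solution f r (x n))"
proof -
  define y where "y = (\<lambda>n. Option.bind (minus_one (component q n)) (rep (target f)))"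
  have rep: "rep (sequences (completion (target f))) q = Some z \<longleftrightarrow> z = y" for z
    by (auto simp: rep_sequences completion_def y_def)
  have "represented_space (sequences (completion (target f)))"
    using f by (simp add: problem_def represented_space_sequences represented_space_completion)
  then have "y \<in> points (sequences (completion (target f)))"
    using rep[of y] by (metis ran_iff represented_space_def)
  then have "names_solution (stashing f) q x \<longleftrightarrow> (\<exists>n. y n \<in> Some ` vals f (x n))"
    using x by (auto simp: names_solution_def stashing_def rep)
  also have "\<dots> \<longleftrightarrow> (\<exists>n r. minus_one (component q n) = Some r \<and> names_solution f r (x n))"
    by (auto simp: y_def names_solution_def image_iff bind_eq_Some_conv)
  finally show ?thesis .
qed

section \<open>Reductions by total maps on names\<close>

lemma computable_total:
  assumes "computable_op 1 (\<lambda>p xs. h p (xs ! 0))"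
  shows "computable (\<lambda>p. Some (h p))"
proof -
  obtain e where "\<And>p xs. length xs = 1 \<Longrightarrow> run e p xs = Some (h p (xs ! 0))"
    using assms unfolding computable_op_def by blast
  then have "run e p [n] = Some (h p n)" for p n
    by simp
  then show ?thesis
    unfolding computable_def by blast
qed

text \<open>A realizer of \<open>g\<close> returns some name of a solution for \<open>k p\<close>;
  hence it is enough that \<open>h\<close> translates every such name correctly.\<close>

lemma sW_leI:
  assumes H: "computable_op 1 (\<lambda>p xs. h p (xs ! 0))"
    and K: "computable_op 1 (\<lambda>p xs. k p (xs ! 0))"
    and red: "\<And>p x. names_instance f p x \<Longrightarrow> \<exists>x'. names_instance g (k p) x' \<and>
      (\<forall>q. names_solution g q x' \<longrightarrow> names_solution f (h q) x)"
  shows "f \<le>\<^sub>s\<^sub>W g"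
proof -
  have "realizer ((\<lambda>p. Some (h p)) \<circ>\<^sub>m (G \<circ>\<^sub>m (\<lambda>p. Some (k p)))) f" if G: "realizer G g" for G
    unfolding realizer_def
  proof (intro allI impI)
    fix p x
    assume "rep (source f) p = Some x \<and> x \<in> mdom f"
    then obtain x' where x': "names_instance g (k p) x'"
      "\<And>q. names_solution g q x' \<Longrightarrow> names_solution f (h q) x"
      using red by (metis names_instance_def)
    obtain q where "G (k p) = Some q" "names_solution g q x'"
      using G x'(1) unfolding realizer_def names_instance_def names_solution_def by blast
    then show "\<exists>q y. ((\<lambda>p. Some (h p)) \<circ>\<^sub>m (G \<circ>\<^sub>m (\<lambda>p. Some (k p)))) p = Some q \<and>
        rep (target f) q = Some y \<and> y \<in> vals f x"
      using x'(2)[of q] by (auto simp: map_comp_def names_solution_def)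
  qed
  then show ?thesis
    unfolding sW_le_def using computable_total[OF H] computable_total[OF K] by blast
qed

section \<open>The reductions\<close>

lemma component_eq: "component p n = (\<lambda>k. p (cpair n k))"
  by (rule ext) (rule component_def)

text \<open>The instance is repeated in every component, as \<open>csnd\<close> forgets the index,
  and answer 0 is returned.\<close>

lemma sW_le_parallelization: "g \<le>\<^sub>s\<^sub>W parallelization g"
proof (rule sW_leI)
  fix p x
  assume "names_instance g p x"
  moreover have "component (\<lambda>z. p (csnd z)) n = p" for n
    by (simp add: component_eq comp_def)
  ultimately show "\<exists>x'. names_instance (parallelization g) (\<lambda>z. p (csnd z)) x' \<and>
      (\<forall>q. names_solution (parallelization g) q x' \<longrightarrow> names_solution g (component q 0) x)"
    by (intro exI[of _ "\<lambda>_. x"])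
      (auto simp: names_instance_parallelization names_solution_parallelization)
qed (auto intro!: computable_intros)

text \<open>Solving component 0 suffices: its answer enters the completion through
  \<open>Suc\<close>, without padding, and is copied everywhere.\<close>

lemma stashing_sW_le:
  assumes "problem g"
  shows "stashing g \<le>\<^sub>s\<^sub>W g"
proof (rule sW_leI)
  fix p x
  assume "names_instance (stashing g) p x"
  then have x: "names_instance g (component p n) (x n)" for n
    using names_instance_stashing[OF assms] by blast
  have "component (\<lambda>z. Suc (q (csnd z))) n = (\<lambda>i. Suc (q i))" for q n
    by (simp add: component_eq comp_def)
  then have "minus_one (component (\<lambda>z. Suc (q (csnd z))) 0) = Some q" for q
    by (simp add: minus_one_Suc)
  moreover have "x n \<in> mdom g" for n
    using x by (simp add: names_instance_def)
  ultimately show "\<exists>x'. names_instance g (component p 0) x' \<and>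
      (\<forall>q. names_solution g q x' \<longrightarrow> names_solution (stashing g) (\<lambda>z. Suc (q (csnd z))) x)"
    using x[of 0] by (intro exI[of _ "x 0"]) (auto simp: names_solution_stashing[OF assms])
qed (auto intro!: computable_intros)

lemma parallelization_stashing_sW_le:
  assumes f: "problem f"
  shows "parallelization (stashing f) \<le>\<^sub>s\<^sub>W stashing (parallelization f)"
proof (rule sW_leI)
  \<comment> \<open>For \<open>?k\<close> the argument codes \<open>(m, (n, i))\<close>; for
    \<open>?h\<close> it codes \<open>(n, (m, s))\<close>, with \<open>s\<close> the stage of the
    rearrangement.\<close>
  let ?k = "\<lambda>p z. p (cpair (cfst (csnd z)) (cpair (cfst z) (csnd (csnd z))))"
  let ?h = "\<lambda>q z. rearrange (component q (cfst (csnd z))) (cpair (cfst z)) (csnd (csnd z))"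
  fix p x
  assume "names_instance (parallelization (stashing f)) p x"
  then have x: "names_instance f (component (component p n) m) (x n m)" for n m
    by (auto simp: names_instance_parallelization names_instance_stashing[OF f])
  then have dom: "x n m \<in> mdom f" for n m
    by (simp add: names_instance_def)
  note Pf = problem_parallelization[OF f]
  let ?x = "\<lambda>m n. x n m"
  have "component (component (?k p) m) n = component (component p n) m" for m n
    by (simp add: component_eq comp_def)
  then have "names_instance (stashing (parallelization f)) (?k p) ?x"
    using x by (simp add: names_instance_parallelization names_instance_stashing[OF Pf])
  moreover have "names_solution (parallelization (stashing f)) (?h q) x"
    if sol: "names_solution (stashing (parallelization f)) q ?x" for q
  proof -
    obtain m r where r: "minus_one (component q m) = Some r"
      "\<And>n. names_solution f (component r n) (x n m)"
      using sol dom
      by (auto simp: names_solution_stashing[OF Pf] mdom_parallelization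
          names_solution_parallelization)
    \<comment> \<open>Requesting the positions \<open>cpair n i\<close> for successive
      \<open>i\<close> extracts component \<open>n\<close> of the word \<open>r\<close>.\<close>
    have "minus_one (component (component (?h q) n) m) = Some (component r n)" for n
      using minus_one_rearrange[OF r(1), of "cpair n"] by (simp add: component_eq comp_def)
    then show ?thesis
      using r(2) dom by (auto simp: names_solution_parallelization names_solution_stashing[OF f])
  qed
  ultimately show "\<exists>x'. names_instance (stashing (parallelization f)) (?k p) x' \<and>
      (\<forall>q. names_solution (stashing (parallelization f)) q x' \<longrightarrow>
        names_solution (parallelization (stashing f)) (?h q) x)"
    by blast
qed (intro computable_intros computable_op_rearrange[where \<sigma> = cpair]; simp)+

lemma parallelization_stashing_parallelization_sW_le:
  assumes f: "problem f"
  shows "parallelization (stashing (parallelization f)) \<le>\<^sub>s\<^sub>W stashing (parallelization f)"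
proof (rule sW_leI)
  let ?k = "\<lambda>p z. p (cpair (cfst (cfst (csnd z)))
    (cpair (cfst z) (cpair (csnd (cfst (csnd z))) (csnd (csnd z)))))"
  \<comment> \<open>The word answers all pairs \<open>(n, j)\<close> at once. With \<open>t\<close>
    coding \<open>(j, i)\<close>, this requests letter \<open>i\<close> of the answer to
    \<open>(n, j)\<close>.\<close>
  let ?\<sigma> = "\<lambda>n t. cpair (cpair n (cfst t)) (csnd t)"
  let ?h = "\<lambda>q z. rearrange (component q (cfst (csnd z))) (?\<sigma> (cfst z)) (csnd (csnd z))"
  note Pf = problem_parallelization[OF f]
  fix p x
  assume "names_instance (parallelization (stashing (parallelization f))) p x"
  then have x: "names_instance f (component (component (component p n) m) j) (x n m j)" for n m j
    by (auto simp: names_instance_parallelization names_instance_stashing[OF Pf])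
  then have dom: "x n m j \<in> mdom f" for n m j
    by (simp add: names_instance_def)
  let ?x = "\<lambda>m z. x (cfst z) m (csnd z)"
  have "component (component (?k p) m) z =
      component (component (component p (cfst z)) m) (csnd z)" for m z
    by (simp add: component_eq comp_def)
  then have "names_instance (stashing (parallelization f)) (?k p) ?x"
    using x by (simp add: names_instance_parallelization names_instance_stashing[OF Pf])
  moreover have "names_solution (parallelization (stashing (parallelization f))) (?h q) x"
    if sol: "names_solution (stashing (parallelization f)) q ?x" for q
  proof -
    obtain m r where r: "minus_one (component q m) = Some r"
      "\<And>z. names_solution f (component r z) (x (cfst z) m (csnd z))"
      using sol dom
      by (auto simp: names_solution_stashing[OF Pf] mdom_parallelization
          names_solution_parallelization)
    have "minus_one (component (component (?h q) n) m) = Some (r \<circ> ?\<sigma> n)" for n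
      using minus_one_rearrange[OF r(1), of "?\<sigma> n"] by (simp add: component_eq comp_def)
    moreover have "component (r \<circ> ?\<sigma> n) j = component r (cpair n j)" for n j
      by (simp add: component_eq comp_def)
    moreover have "names_solution f (component r (cpair n j)) (x n m j)" for n j
      using r(2)[of "cpair n j"] by simp
    ultimately show ?thesis
      using dom by (auto simp: names_solution_parallelization names_solution_stashing[OF Pf]
          mdom_parallelization intro!: exI[of _ m])
  qed
  ultimately show "\<exists>x'. names_instance (stashing (parallelization f)) (?k p) x' \<and>
      (\<forall>q. names_solution (stashing (parallelization f)) q x' \<longrightarrow>
        names_solution (parallelization (stashing (parallelization f))) (?h q) x)"
    by blast
qed (intro computable_intros
    computable_op_rearrange[where \<sigma> = "\<lambda>n t. cpair (cpair n (cfst t)) (csnd t)"]; simp)+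

lemma parallelization_stashing_sW_le_stashing_parallelization_stashing:
  assumes f: "problem f"
  shows "parallelization (stashing f) \<le>\<^sub>s\<^sub>W stashing (parallelization (stashing f))"
proof (rule sW_leI)
  let ?k = "\<lambda>p z. p (cpair (cfst (csnd z))
    (cpair (cpair (cfst z) (cfst (csnd (csnd z)))) (csnd (csnd (csnd z)))))"
  \<comment> \<open>Here \<open>v\<close> codes \<open>(n, j)\<close>, packed into the single
    parameter that \<open>computable_op_rearrange\<close> provides; the request selects component
    \<open>j\<close> of component \<open>n\<close>.\<close>
  let ?\<sigma> = "\<lambda>v t. cpair (cfst v) (cpair (csnd v) t)"
  let ?h = "\<lambda>q z. rearrange (component q (cfst (cfst (csnd z))))
    (?\<sigma> (cpair (cfst z) (csnd (cfst (csnd z))))) (csnd (csnd z)) - 1"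
  note PSf = problem_parallelization[OF problem_stashing[OF f]]
  fix p x
  assume "names_instance (parallelization (stashing f)) p x"
  then have x: "names_instance f (component (component p n) z) (x n z)" for n z
    by (auto simp: names_instance_parallelization names_instance_stashing[OF f])
  then have dom: "x n z \<in> mdom f" for n z
    by (simp add: names_instance_def)
  let ?x = "\<lambda>m n j. x n (cpair m j)"
  have "component (component (component (?k p) m) n) j =
      component (component p n) (cpair m j)" for m n j
    by (simp add: component_eq comp_def)
  then have "names_instance (stashing (parallelization (stashing f))) (?k p) ?x"
    using x by (simp add: names_instance_parallelization names_instance_stashing[OF f]
        names_instance_stashing[OF PSf])
  moreover have "names_solution (parallelization (stashing f)) (?h q) x"
    if sol: "names_solution (stashing (parallelization (stashing f))) q ?x" for q
  proof -
    \<comment> \<open>The outer index \<open>m\<close> is common to all \<open>n\<close>, whereas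
      \<open>j\<close> and \<open>u\<close> depend on \<open>n\<close>; the right answer for
      \<open>n\<close> thus belongs at index \<open>cpair m j\<close>.\<close>
    obtain m r where r: "minus_one (component q m) = Some r"
      "\<And>n. \<exists>j u. minus_one (component (component r n) j) = Some u \<and>
        names_solution f u (x n (cpair m j))"
      using sol dom
      by (auto simp: names_solution_stashing[OF PSf] names_solution_stashing[OF f]
          mdom_parallelization mdom_stashing[OF f] names_solution_parallelization)
    have "\<exists>z u. minus_one (component (component (?h q) n) z) = Some u \<and>
        names_solution f u (x n z)" for n
    proof -
      obtain j u where u: "minus_one (component (component r n) j) = Some u"
        "names_solution f u (x n (cpair m j))"
        using r(2) by blast
      have "r \<circ> ?\<sigma> (cpair n j) = component (component r n) j"
        by (simp add: component_eq comp_def)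
      then have "minus_one (rearrange (component q m) (?\<sigma> (cpair n j))) =
          Some (component (component r n) j)"
        using minus_one_rearrange[OF r(1), of "?\<sigma> (cpair n j)"] by simp
      \<comment> \<open>The extracted word is itself a padded name of a point of the completion; the
        \<open>- 1\<close> in \<open>?h\<close> removes the outer coding.\<close>
      from minus_one_pred[OF this u(1)]
      have "minus_one (component (component (?h q) n) (cpair m j)) = Some u"
        by (simp add: component_eq comp_def)
      then show ?thesis
        using u(2) by blast
    qed
    then show ?thesis
      using dom by (auto simp: names_solution_parallelization names_solution_stashing[OF f])
  qed
  ultimately show "\<exists>x'. names_instance (stashing (parallelization (stashing f))) (?k p) x' \<and>
      (\<forall>q. names_solution (stashing (parallelization (stashing f))) q x' \<longrightarrow>
        names_solution (parallelization (stashing f)) (?h q) x)"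
    by blast
qed (intro computable_intros
    computable_op_rearrange[where \<sigma> = "\<lambda>v t. cpair (cfst v) (cpair (csnd v) t)"]; simp)+

theorem proposition3p2:
  fixes f :: "('a, 'b) multimap"
  assumes "problem f"
  shows "parallelization (stashing f) \<le>\<^sub>s\<^sub>W stashing (parallelization f) \<and>
         parallelization (stashing (parallelization f)) \<equiv>\<^sub>s\<^sub>W stashing (parallelization f) \<and>
         stashing (parallelization (stashing f)) \<equiv>\<^sub>s\<^sub>W parallelization (stashing f)"
  unfolding sW_equiv_def
  using parallelization_stashing_sW_le[OF assms]
    parallelization_stashing_parallelization_sW_le[OF assms]
    parallelization_stashing_sW_le_stashing_parallelization_stashing[OF assms]
    sW_le_parallelization stashing_sW_le[OF problem_parallelization[OF problem_stashing[OF assms]]]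
  by blast

end
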